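(* Let $\mathcal{M}\subset\mathcal{L}$ be the space of leaves of a semi-nondegenerate smooth foliation of $\mathbb{H}^3$ by oriented geodesics. Then the forward and backward Gauss maps $\varphi^\pm|_{\mathcal{M}}:\mathcal{M}\to\mathbb{H}^3(\infty)$ are injective; in particular they are diffeomorphisms onto their images.
   Context: $\mathbb{H}^3$ is the three-dimensional hyperbolic space of curvature $-1$; $\mathcal{L}$ is the smooth 4-manifold of complete oriented geodesics of $\mathbb{H}^3$. A smooth foliation of $\mathbb{H}^3$ by oriented geodesics is given by a smooth unit vector field $V$ all of whose integral curves are geodesics; its space of leaves $\mathcal{M}$ is a 2-dimensional submanifold of $\mathcal{L}$. $\mathbb{H}^3(\infty)$ is the sphere at infinity, the set of equivalence classes of asymptotic unit speed geodesics (two geodesics $\gamma,\sigma$ being asymptotic if $d(\gamma(s),\sigma(s))$ is bounded for $s\ge0$), with its canonical smooth structure diffeomorphic to $S^2$. The Gauss maps are $\varphi^\pm([\gamma])=\gamma(\pm\infty)$, where $\gamma(\infty)$ is the class of $\gamma$ and $\gamma(-\infty)$ the class of $s\mapsto\gamma(-s)$. The foliation is semi-nondegenerate if $\varphi^\pm|_{\mathcal{M}}$ are both local diffeomorphisms. *)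

theory Defs
  imports "HOL-Analysis.Analysis"
begin

fun Ck_on :: "nat \<Rightarrow> 'a::euclidean_space set \<Rightarrow> ('a \<Rightarrow> 'b::real_normed_vector) \<Rightarrow> bool" where
  "Ck_on 0 S f = continuous_on S f"
| "Ck_on (Suc k) S f =
     (f differentiable_on S \<and>
      (\<forall>b\<in>Basis. Ck_on k S (\<lambda>x. frechet_derivative f (at x) b)))"

definition smooth_on :: "'a::euclidean_space set \<Rightarrow> ('a \<Rightarrow> 'b::real_normed_vector) \<Rightarrow> bool" where
  "smooth_on S f \<longleftrightarrow> open S \<and> (\<forall>k. Ck_on k S f)"

definition smooth_map_on :: "'a::euclidean_space set \<Rightarrow> ('a \<Rightarrow> 'b::real_normed_vector) \<Rightarrow> bool" where
  "smooth_map_on A f \<longleftrightarrow>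
     (\<forall>x\<in>A. \<exists>W g. open W \<and> x \<in> W \<and> smooth_on W g \<and> (\<forall>y\<in>A \<inter> W. g y = f y))"

definition local_diffeo_on :: "'a::euclidean_space set \<Rightarrow> ('a \<Rightarrow> 'b::euclidean_space) \<Rightarrow> 'b set \<Rightarrow> bool" where
  "local_diffeo_on M f N \<longleftrightarrow> f ` M \<subseteq> N \<and>
     (\<forall>m\<in>M. \<exists>U W g. openin (top_of_set M) U \<and> m \<in> U \<and> openin (top_of_set N) W \<and>
        bij_betw f U W \<and> smooth_map_on U f \<and> smooth_map_on W g \<and>
        (\<forall>x\<in>U. g (f x) = x))"

definition diffeo_betw :: "('a::euclidean_space \<Rightarrow> 'b::euclidean_space) \<Rightarrow> 'a set \<Rightarrow> 'b set \<Rightarrow> bool" where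
  "diffeo_betw f A B \<longleftrightarrow> bij_betw f A B \<and> smooth_map_on A f \<and> smooth_map_on B (inv_into A f)"

type_synonym pt = "real \<times> (real^3)"

definition mink :: "pt \<Rightarrow> pt \<Rightarrow> real" where
  "mink u w = - fst u * fst w + snd u \<bullet> snd w"

definition H3 :: "pt set" where
  "H3 = {x. mink x x = -1 \<and> fst x > 0}"

definition unit_tangent :: "pt \<Rightarrow> pt \<Rightarrow> bool" where
  "unit_tangent p v \<longleftrightarrow> p \<in> H3 \<and> mink p v = 0 \<and> mink v v = 1"

definition geod :: "pt \<Rightarrow> pt \<Rightarrow> real \<Rightarrow> pt" where
  "geod p v t = cosh t *\<^sub>R p + sinh t *\<^sub>R v"

text \<open>global chart of H3 (inverse of the projection to the last three coordinates)\<close>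
definition lift :: "real^3 \<Rightarrow> pt" where
  "lift y = (sqrt (1 + y \<bullet> y), y)"

text \<open>Sphere at infinity: projectivised future light cone, identified with the unit sphere S^2;
  a future null vector u represents the ideal point snd u / fst u.\<close>
definition S2 :: "(real^3) set" where
  "S2 = sphere 0 1"

definition ideal_pt :: "pt \<Rightarrow> real^3" where
  "ideal_pt u = (1 / fst u) *\<^sub>R snd u"

definition end_plus :: "pt \<Rightarrow> pt \<Rightarrow> real^3" where
  "end_plus p v = ideal_pt (p + v)"

definition end_minus :: "pt \<Rightarrow> pt \<Rightarrow> real^3" where
  "end_minus p v = ideal_pt (p - v)"

definition integral_curve :: "(pt \<Rightarrow> pt) \<Rightarrow> (real \<Rightarrow> pt) \<Rightarrow> real set \<Rightarrow> bool" where
  "integral_curve V c I \<longleftrightarrow> is_interval I \<and> open I \<and>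
     (\<forall>t\<in>I. c t \<in> H3 \<and> (c has_vector_derivative V (c t)) (at t))"

definition is_geodesic_on :: "(real \<Rightarrow> pt) \<Rightarrow> real set \<Rightarrow> bool" where
  "is_geodesic_on c I \<longleftrightarrow> (\<exists>p v. unit_tangent p v \<and> (\<forall>t\<in>I. c t = geod p v t))"

definition geodesic_foliation :: "(pt \<Rightarrow> pt) \<Rightarrow> bool" where
  "geodesic_foliation V \<longleftrightarrow>
     smooth_on UNIV (\<lambda>y. V (lift y)) \<and>
     (\<forall>p\<in>H3. unit_tangent p (V p)) \<and>
     (\<forall>c I. integral_curve V c I \<longrightarrow> is_geodesic_on c I)"

text \<open>An oriented geodesic is represented by its pair of endpoints (gamma(-inf), gamma(+inf))
  in S^2 x S^2 minus the diagonal (the canonical identification of the space L of oriented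
  geodesics). The space of leaves M is the set of leaves through the points of H3;
  the Gauss maps phi^- and phi^+ are then fst and snd.\<close>
definition leaf_space :: "(pt \<Rightarrow> pt) \<Rightarrow> ((real^3) \<times> (real^3)) set" where
  "leaf_space V = {(end_minus p (V p), end_plus p (V p)) | p. p \<in> H3}"

definition gauss_minus :: "(real^3) \<times> (real^3) \<Rightarrow> real^3" where
  "gauss_minus = fst"

definition gauss_plus :: "(real^3) \<times> (real^3) \<Rightarrow> real^3" where
  "gauss_plus = snd"

definition semi_nondegenerate :: "(pt \<Rightarrow> pt) \<Rightarrow> bool" where
  "semi_nondegenerate V \<longleftrightarrow>
     local_diffeo_on (leaf_space V) gauss_plus S2 \<and> local_diffeo_on (leaf_space V) gauss_minus S2"

end

theory Submission
  imports Defs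
begin

text \<open>
  In the Klein model the leaves are pairwise disjoint open chords of the unit ball. Let two leaves
  end at the same ideal point \<open>p\<close>, and let \<open>q \<mapsto> (\<beta> q, q)\<close> be a local inverse of the forward Gauss
  map near the first one. Take a point \<open>z\<close> of the second chord close to \<open>p\<close>, and send \<open>q\<close> to the
  second intersection with the sphere of the line through \<open>\<beta> q\<close> and \<open>z\<close>. As \<open>z\<close> tends to \<open>p\<close> this
  map tends to \<open>p\<close> uniformly, so it preserves a small cap around \<open>p\<close> and by Brouwer has a fixed
  point \<open>q\<close>. The chord from \<open>\<beta> q\<close> to \<open>q\<close> then passes through \<open>z\<close>, hence it is the second chord;
  so \<open>q = p\<close>, and both leaves start at \<open>\<beta> p\<close>.

  That every leaf is a complete geodesic needs the local existence of integral curves, since the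
  hypothesis on the vector field only speaks about curves that are given.
\<close>

section \<open>Local existence for Lipschitz differential equations\<close>

text \<open>Picard iteration: on a time interval short compared with \<open>1 / L\<close> the
  integral operator contracts the bounded continuous functions by 1/2, so Banach's theorem yields a
  solution.\<close>

lemma lipschitz_ode_solution:
  fixes f :: "'a::euclidean_space \<Rightarrow> 'a"
  assumes lip: "L-lipschitz_on UNIV f"
  obtains \<tau> y where "\<tau> > 0" "y 0 = y0"
    "\<And>t. t \<in> {-\<tau><..<\<tau>} \<Longrightarrow> (y has_vector_derivative f (y t)) (at t)"
proof -
  have L: "L \<ge> 0" using lip by (rule lipschitz_on_nonneg)
  have contf: "continuous_on S f" for S
    using lipschitz_on_continuous_on[OF lip] continuous_on_subset by blast
  \<comment> \<open>Two integrals over an interval of length at most \<open>2 * \<tau>\<close> are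
    compared below, so \<open>4 * \<tau> * L\<close> must be at most 1/2. The summand 1 covers
    \<open>L = 0\<close>.\<close>
  define \<tau> where "\<tau> = 1 / (8 * (L + 1))"
  have \<tau>: "\<tau> > 0" "4 * \<tau> * L \<le> 1 / 2"
    using L by (auto simp: \<tau>_def field_simps)
  \<comment> \<open>Starting at \<open>-\<tau>\<close> keeps the bounds of integration ordered for
    negative times too; subtracting \<open>I x 0\<close> later restores the initial condition at
    time 0.\<close>
  define I where "I x u = integral {-\<tau>..u} (\<lambda>s. f (apply_bcontfun x s))" for x u
  \<comment> \<open>Clamping the time makes the Picard operator act on bounded continuous functions on the whole line.\<close>
  define \<Phi> where "\<Phi> x t = y0 + I x (max (-\<tau>) (min \<tau> t)) - I x 0" for x t
  have contg: "continuous_on S (\<lambda>s. f (apply_bcontfun x s))" for S x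
    by (rule continuous_on_compose2[OF contf[of UNIV]]) auto
  have "\<Phi> x \<in> bcontfun" for x
  proof -
    have contI: "continuous_on {-\<tau>..\<tau>} (I x)"
      unfolding I_def
      by (intro indefinite_integral_continuous_1 integrable_continuous_real contg)
    have "continuous_on UNIV (\<Phi> x)"
      unfolding \<Phi>_def
      by (intro continuous_intros continuous_on_compose2[OF contI]) (use \<tau> in auto)
    moreover have "range (\<Phi> x) \<subseteq> (\<lambda>u. y0 + I x u - I x 0) ` {-\<tau>..\<tau>}"
      unfolding \<Phi>_def using \<tau> by (auto intro!: imageI)
    moreover have "compact ((\<lambda>u. y0 + I x u - I x 0) ` {-\<tau>..\<tau>})"
      by (intro compact_continuous_image continuous_intros contI) auto
    ultimately show ?thesis
      unfolding bcontfun_def by (auto intro: bounded_subset compact_imp_bounded)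
  qed
  then have \<Phi>: "apply_bcontfun (Bcontfun (\<Phi> x)) = \<Phi> x" for x
    by (simp add: Bcontfun_inverse)
  have diff: "norm (I x u - I z u) \<le> 2 * \<tau> * L * dist x z" if "u \<in> {-\<tau>..\<tau>}" for x z u
  proof -
    have "I x u - I z u = integral {-\<tau>..u} (\<lambda>s. f (x s) - f (z s))"
      unfolding I_def by (intro integral_diff[symmetric] integrable_continuous_real contg)
    also have "norm \<dots> \<le> (L * dist x z) * (u - - \<tau>)"
    proof (rule integral_bound)
      fix t
      have "norm (f (x t) - f (z t)) \<le> L * dist (x t) (z t)"
        using lipschitz_onD[OF lip, of "x t" "z t"] by (simp add: dist_norm)
      also have "\<dots> \<le> L * dist x z"
        using L by (intro mult_left_mono dist_bounded)
      finally show "norm (f (x t) - f (z t)) \<le> L * dist x z" .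
    qed (use that in \<open>auto intro!: continuous_intros contg\<close>)
    also have "\<dots> \<le> (L * dist x z) * (2 * \<tau>)"
      using that L by (intro mult_left_mono) auto
    finally show ?thesis by (simp add: algebra_simps)
  qed
  have "\<exists>!x. Bcontfun (\<Phi> x) = x"
  proof (rule banach_fix_type[of "1 / 2"], safe)
    fix x z
    show "dist (Bcontfun (\<Phi> x)) (Bcontfun (\<Phi> z)) \<le> 1 / 2 * dist x z"
    proof (rule dist_bound)
      fix t
      define u where "u = max (-\<tau>) (min \<tau> t)"
      have u: "u \<in> {-\<tau>..\<tau>}" "0 \<in> {-\<tau>..\<tau>}" using \<tau> by (auto simp: u_def)
      have "dist (\<Phi> x t) (\<Phi> z t) = norm ((I x u - I z u) - (I x 0 - I z 0))"
        by (simp add: \<Phi>_def u_def dist_norm algebra_simps)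
      also have "\<dots> \<le> 2 * \<tau> * L * dist x z + 2 * \<tau> * L * dist x z"
        using diff[OF u(1), of x z] diff[OF u(2), of x z] norm_triangle_ineq4 by (smt (verit))
      also have "\<dots> = (4 * \<tau> * L) * dist x z" by simp
      also have "\<dots> \<le> 1 / 2 * dist x z"
        using \<tau>(2) by (intro mult_right_mono) auto
      finally show "dist (Bcontfun (\<Phi> x) t) (Bcontfun (\<Phi> z) t) \<le> 1 / 2 * dist x z"
        by (simp add: \<Phi>)
    qed
  qed auto
  then obtain x where "Bcontfun (\<Phi> x) = x" by blast
  then have fp: "apply_bcontfun x = \<Phi> x" using \<Phi>[of x] by simp
  show thesis
  proof
    show "\<tau> > 0" by fact
    show "x 0 = y0" unfolding fp using \<tau> by (simp add: \<Phi>_def)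
    fix t assume t: "t \<in> {-\<tau><..<\<tau>}"
    have "(I x has_vector_derivative f (x t)) (at t within {-\<tau>..\<tau>})"
      unfolding I_def by (rule integral_has_vector_derivative[OF contg]) (use t in auto)
    then have "(I x has_vector_derivative f (x t)) (at t)"
      using t at_within_interior[of t "{-\<tau>..\<tau>}"] by (simp add: interior_atLeastAtMost_real)
    then have "((\<lambda>t. y0 + I x t - I x 0) has_vector_derivative f (x t)) (at t)"
      by (auto intro!: derivative_eq_intros)
    then show "(apply_bcontfun x has_vector_derivative f (x t)) (at t)"
      by (rule has_vector_derivative_transform_within_open[where S = "{-\<tau><..<\<tau>}"])
        (use t in \<open>auto simp: fp \<Phi>_def min_def max_def\<close>)
  qed
qed

lemma locally_lipschitz_ode_solution:
  fixes f :: "'a::euclidean_space \<Rightarrow> 'a"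
  assumes lip: "L-lipschitz_on (cball y0 r) f" and r: "r > 0"
  obtains \<tau> y where "\<tau> > 0" "y 0 = y0"
    "\<And>t. t \<in> {-\<tau><..<\<tau>} \<Longrightarrow> (y has_vector_derivative f (y t)) (at t)"
proof -
  \<comment> \<open>Precomposing with the projection to the ball makes the field globally Lipschitz.\<close>
  have cp: "1-lipschitz_on UNIV (closest_point (cball y0 r))"
    using r closest_point_lipschitz[of "cball y0 r"] by (auto intro!: lipschitz_onI)
  have "L-lipschitz_on (closest_point (cball y0 r) ` UNIV) f"
    by (rule lipschitz_on_subset[OF lip]) (use r closest_point_in_set[of "cball y0 r"] in force)
  then have "(L * 1)-lipschitz_on UNIV (\<lambda>y. f (closest_point (cball y0 r) y))"
    by (rule lipschitz_on_compose2[OF cp])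
  then obtain \<tau> y where y: "\<tau> > 0" "y 0 = y0"
    "\<And>t. t \<in> {-\<tau><..<\<tau>} \<Longrightarrow>
       (y has_vector_derivative f (closest_point (cball y0 r) (y t))) (at t)"
    by (rule lipschitz_ode_solution[where ?y0.0 = y0]) auto
  \<comment> \<open>By continuity the solution stays in the ball for a short time, and there the
    projection is the identity.\<close>
  have "isCont y 0"
    using has_vector_derivative_continuous[OF y(3)[of 0]] y(1) by simp
  then obtain \<delta> where \<delta>: "\<delta> > 0" "\<And>t. dist t 0 < \<delta> \<Longrightarrow> dist (y t) (y 0) < r"
    unfolding continuous_at_eps_delta dist_norm using r by blast
  have "(y has_vector_derivative f (y t)) (at t)" if "t \<in> {-min \<tau> \<delta><..<min \<tau> \<delta>}" for t
  proof -
    have "dist t 0 < \<delta>" using that by (auto simp: dist_real_def)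
    then have "y t \<in> cball y0 r"
      using \<delta>(2)[of t] y(2) by (simp add: dist_commute)
    then show ?thesis using y(3)[of t] that by (auto simp: closest_point_self)
  qed
  then show thesis using that[of "min \<tau> \<delta>" y] y \<delta> by simp
qed


text \<open>The operator norm of the derivative is at most the sum of the norms of the partial
  derivatives. That sum is continuous, hence bounded on the compact ball, and convexity of the ball
  turns this into a Lipschitz bound.\<close>

lemma C1_lipschitz_on_cball:
  fixes f :: "'a::euclidean_space \<Rightarrow> 'b::real_normed_vector"
  assumes "Ck_on 1 UNIV f"
  obtains L where "L-lipschitz_on (cball y0 r) f"
proof -
  have df: "f differentiable (at x)" for x
    using assms by (simp add: differentiable_on_def)
  define g where "g x = (\<Sum>b\<in>Basis. norm (frechet_derivative f (at x) b))" for x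
  have "continuous_on (cball y0 r) g"
    unfolding g_def using assms
    by (auto intro!: continuous_intros intro: continuous_on_subset)
  then have "compact (g ` cball y0 r)"
    by (rule compact_continuous_image) simp
  from compact_imp_bounded[OF this]
  obtain L where L: "\<forall>x\<in>cball y0 r. norm (g x) \<le> L"
    unfolding bounded_iff by blast
  have o: "onorm (frechet_derivative f (at x)) \<le> g x" for x
    unfolding g_def
    by (rule onorm_componentwise,
        rule has_derivative_bounded_linear[OF frechet_derivative_works[THEN iffD1, OF df]])
  have B: "onorm (frechet_derivative f (at x)) \<le> max L 0" if "x \<in> cball y0 r" for x
  proof -
    have "norm (g x) \<le> L" using L that by blast
    then show ?thesis using o[of x] by (simp add: abs_le_iff le_max_iff_disj)
  qed
  have "(max L 0)-lipschitz_on (cball y0 r) f"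
  proof (rule bounded_derivative_imp_lipschitz)
    show "(f has_derivative frechet_derivative f (at x)) (at x within cball y0 r)" for x
      using df frechet_derivative_works has_derivative_at_withinI by blast
  qed (use B in auto)
  then show thesis by (rule that)
qed

section \<open>Geodesics of the foliation\<close>

definition geod_velocity :: "pt \<Rightarrow> pt \<Rightarrow> real \<Rightarrow> pt" where
  "geod_velocity p v t = sinh t *\<^sub>R p + cosh t *\<^sub>R v"

lemma geod_has_vector_derivative:
  "(geod p v has_vector_derivative geod_velocity p v t) (at t)"
  unfolding geod_def[abs_def] geod_velocity_def has_vector_derivative_def
  by (auto intro!: derivative_eq_intros simp: algebra_simps)

lemma mink_add_left: "mink (u + v) w = mink u w + mink v w"
  and mink_add_right: "mink w (u + v) = mink w u + mink w v"
  and mink_scaleR_left: "mink (c *\<^sub>R u) w = c * mink u w"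
  and mink_scaleR_right: "mink w (c *\<^sub>R u) = c * mink w u"
  and mink_diff_left: "mink (u - v) w = mink u w - mink v w"
  and mink_diff_right: "mink w (u - v) = mink w u - mink w v"
  by (simp_all add: mink_def algebra_simps)

lemmas mink_bilinear = mink_add_left mink_add_right mink_scaleR_left mink_scaleR_right
  mink_diff_left mink_diff_right

lemma mink_commute: "mink u w = mink w u"
  by (simp add: mink_def inner_commute algebra_simps)

text \<open>Cauchy-Schwarz for the spatial parts. It makes the null vectors \<open>p + v\<close> and
  \<open>p - v\<close> future-directed, so that their ideal points are given by an honest
  division.\<close>

lemma unit_tangent_fst_less:
  assumes "unit_tangent p v"
  shows "\<bar>fst v\<bar> < fst p"
proof -
  have p: "snd p \<bullet> snd p = (fst p)\<^sup>2 - 1" "fst p > 0"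
    and v: "snd v \<bullet> snd v = (fst v)\<^sup>2 + 1"
    and pv: "fst p * fst v = snd p \<bullet> snd v"
    using assms by (auto simp: unit_tangent_def H3_def mink_def power2_eq_square)
  have "(fst p * fst v)\<^sup>2 \<le> ((fst p)\<^sup>2 - 1) * ((fst v)\<^sup>2 + 1)"
    unfolding pv p(1)[symmetric] v(1)[symmetric] by (rule Cauchy_Schwarz_ineq)
  then have "(fst v)\<^sup>2 < (fst p)\<^sup>2"
    by (simp add: algebra_simps power_mult_distrib)
  then show ?thesis
    using p(2) power2_less_imp_less[of "\<bar>fst v\<bar>" "fst p"] by simp
qed

lemma unit_tangent_geod:
  assumes "unit_tangent p v"
  shows "unit_tangent (geod p v t) (geod_velocity p v t)"
proof -
  have m: "mink p p = -1" "mink p v = 0" "mink v p = 0" "mink v v = 1"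
    using assms by (auto simp: unit_tangent_def H3_def mink_commute)
  have "(sinh t)\<^sup>2 < (cosh t)\<^sup>2" by (simp add: cosh_square_eq)
  then have "\<bar>sinh t\<bar> < cosh t" 
    using power2_less_imp_less[of "\<bar>sinh t\<bar>" "cosh t"] by simp
  then have "\<bar>sinh t * fst v\<bar> < cosh t * fst p"
    using unit_tangent_fst_less[OF assms] by (auto simp: abs_mult intro!: mult_strict_mono')
  then have "fst (geod p v t) > 0"
    by (auto simp: geod_def)
  then show ?thesis
    using cosh_square_eq[of t]
    by (simp add: unit_tangent_def H3_def geod_def geod_velocity_def mink_bilinear m
        power2_eq_square algebra_simps)
qed

section \<open>Integral curves through the global chart of the hyperboloid\<close>

lemma lift_snd:
  assumes "p \<in> H3"
  shows "lift (snd p) = p"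
proof -
  have "1 + snd p \<bullet> snd p = (fst p)\<^sup>2" "fst p > 0"
    using assms by (auto simp: H3_def mink_def power2_eq_square)
  then show ?thesis by (simp add: lift_def prod_eq_iff)
qed

lemma lift_in_H3: "lift y \<in> H3"
proof -
  have "1 + y \<bullet> y > 0" by (smt (verit) inner_ge_zero)
  then show ?thesis by (simp add: lift_def H3_def mink_def flip: power2_eq_square)
qed

text \<open>Tangency to the hyperboloid determines the time component of \<open>v\<close> from its
  spatial part, and its value is exactly the derivative of the square root in
  \<open>lift\<close>.\<close>

lemma lift_has_vector_derivative:
  assumes "(y has_vector_derivative snd v) (at t)" and "mink (lift (y t)) v = 0"
  shows "((\<lambda>t. lift (y t)) has_vector_derivative v) (at t)"
proof -
  define s where "s = sqrt (1 + y t \<bullet> y t)"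
  have pos: "1 + y t \<bullet> y t > 0" by (smt (verit) inner_ge_zero)
  then have s: "s > 0" by (simp add: s_def)
  have fv: "s * fst v = y t \<bullet> snd v"
    using assms(2) by (simp add: mink_def lift_def s_def)
  have d: "(y has_derivative (\<lambda>h. h *\<^sub>R snd v)) (at t)"
    using assms(1) by (simp add: has_vector_derivative_def)
  have "((\<lambda>t. 1 + y t \<bullet> y t) has_real_derivative 2 * (y t \<bullet> snd v)) (at t)"
    unfolding has_field_derivative_def
    by (auto intro!: derivative_eq_intros d simp: inner_commute algebra_simps)
  from DERIV_chain2[where f = sqrt, OF DERIV_real_sqrt[OF pos] this]
  have "((\<lambda>t. sqrt (1 + y t \<bullet> y t)) has_real_derivative fst v) (at t)"
    using s unfolding fv[symmetric] by (simp add: s_def[symmetric] field_simps)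
  then have "((\<lambda>t. (sqrt (1 + y t \<bullet> y t), y t)) has_vector_derivative (fst v, snd v)) (at t)"
    using assms(1) has_real_derivative_iff_has_vector_derivative
    by (intro has_vector_derivative_Pair) auto
  then show ?thesis by (simp add: lift_def)
qed

text \<open>The values of \<open>V\<close> off the hyperboloid are arbitrary, so the equation is
  solved in the chart, where \<open>V\<close> composed with \<open>lift\<close> is smooth, and the
  solution is lifted back.\<close>

lemma integral_curve_exists:
  assumes V: "geodesic_foliation V" and p: "p \<in> H3"
  obtains \<tau> c where "\<tau> > 0" "c 0 = p" "integral_curve V c {-\<tau><..<\<tau>}"
proof -
  have "Ck_on 1 UNIV (\<lambda>y. V (lift y))"
    using V unfolding geodesic_foliation_def smooth_on_def by blast
  then obtain L where L: "L-lipschitz_on (cball (snd p) 1) (\<lambda>y. V (lift y))"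
    by (rule C1_lipschitz_on_cball)
  have "1-lipschitz_on UNIV (snd :: pt \<Rightarrow> _)"
    by (intro lipschitz_onI) (simp_all add: dist_snd_le)
  then have "(1 * L)-lipschitz_on (cball (snd p) 1) (\<lambda>y. snd (V (lift y)))"
    by (rule lipschitz_on_compose2[OF L, OF lipschitz_on_subset]) auto
  then obtain \<tau> y where y: "\<tau> > 0" "y 0 = snd p"
    "\<And>t. t \<in> {-\<tau><..<\<tau>} \<Longrightarrow> (y has_vector_derivative snd (V (lift (y t)))) (at t)"
    by (rule locally_lipschitz_ode_solution) auto
  have "integral_curve V (\<lambda>t. lift (y t)) {-\<tau><..<\<tau>}"
    unfolding integral_curve_def
  proof (intro conjI ballI)
    fix t assume t: "t \<in> {-\<tau><..<\<tau>}"
    show "((\<lambda>t. lift (y t)) has_vector_derivative V (lift (y t))) (at t)"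
      using V lift_in_H3
      by (intro lift_has_vector_derivative y(3)[OF t])
        (auto simp: geodesic_foliation_def unit_tangent_def)
  qed (auto simp: lift_in_H3 is_interval_oo)
  then show thesis using that[of \<tau> "\<lambda>t. lift (y t)"] y(1,2) lift_snd[OF p] by simp
qed

section \<open>Leaves are complete geodesics\<close>

lemma geod_add:
  "geod (geod p v s) (geod_velocity p v s) t = geod p v (s + t)"
  "geod_velocity (geod p v s) (geod_velocity p v s) t = geod_velocity p v (s + t)"
  by (simp_all add: geod_def geod_velocity_def cosh_add sinh_add algebra_simps)

text \<open>The integral curve through \<open>p\<close> is a geodesic by hypothesis; comparing
  position and velocity at time 0 shows which one.\<close>

lemma foliation_along_geod_local:
  assumes V: "geodesic_foliation V" and p: "p \<in> H3"
  obtains \<tau> where "\<tau> > 0" "\<And>t. \<bar>t\<bar> < \<tau> \<Longrightarrow> V (geod p (V p) t) = geod_velocity p (V p) t"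
proof -
  obtain \<tau> c where c: "\<tau> > 0" "c 0 = p" "integral_curve V c {-\<tau><..<\<tau>}"
    using integral_curve_exists[OF assms] .
  then obtain q w where q: "\<And>t. t \<in> {-\<tau><..<\<tau>} \<Longrightarrow> c t = geod q w t"
    using V unfolding geodesic_foliation_def is_geodesic_on_def by metis
  have d: "V (c t) = geod_velocity q w t" if "t \<in> {-\<tau><..<\<tau>}" for t
  proof (rule vector_derivative_unique_at)
    show "(c has_vector_derivative V (c t)) (at t)"
      using c(3) that by (auto simp: integral_curve_def)
    show "(c has_vector_derivative geod_velocity q w t) (at t)"
      by (rule has_vector_derivative_transform_within_open
          [OF geod_has_vector_derivative, where S = "{-\<tau><..<\<tau>}"])
        (use that q in auto)
  qed
  have "p = q" "V p = w"
    using q[of 0] d[of 0] c(1,2) by (simp_all add: geod_def geod_velocity_def)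
  then show thesis using that[of \<tau>] c(1) d q by (auto simp: abs_less_iff)
qed

text \<open>Connectedness of the real line: the set of good times contains 0, is closed by
  continuity, and is open by the local statement restarted at a later point of the geodesic.\<close>

lemma foliation_along_geod:
  assumes V: "geodesic_foliation V" and p: "p \<in> H3"
  shows "V (geod p (V p) t) = geod_velocity p (V p) t"
proof -
  let ?\<gamma> = "geod p (V p)" and ?\<gamma>' = "geod_velocity p (V p)"
  define T where "T = {t. V (?\<gamma> t) = ?\<gamma>' t}"
  have ut: "unit_tangent p (V p)"
    using V p by (simp add: geodesic_foliation_def)
  have H: "?\<gamma> t \<in> H3" for t
    using unit_tangent_geod[OF ut] by (simp add: unit_tangent_def)
  have "Ck_on 0 UNIV (\<lambda>y. V (lift y))"
    using V unfolding geodesic_foliation_def smooth_on_def by blast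
  then have contV: "continuous_on UNIV (\<lambda>y. V (lift y))" by simp
  have cont: "continuous_on UNIV (\<lambda>t. V (lift (snd (?\<gamma> t))))"
    by (rule continuous_on_compose2[OF contV])
      (auto simp: geod_def intro!: continuous_intros)
  have "closed T"
    unfolding T_def
    by (rule closed_Collect_eq)
      (use cont in \<open>auto simp: lift_snd H geod_velocity_def intro!: continuous_intros\<close>)
  moreover have "open T"
    unfolding open_dist
  proof (intro ballI)
    fix s assume s: "s \<in> T"
    obtain \<tau> where \<tau>: "\<tau> > 0" "\<And>t. \<bar>t\<bar> < \<tau> \<Longrightarrow> V (geod (?\<gamma> s) (V (?\<gamma> s)) t) = geod_velocity (?\<gamma> s) (V (?\<gamma> s)) t"
      using foliation_along_geod_local[OF V H] by metis
    have "r \<in> T" if "dist r s < \<tau>" for r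
      using \<tau>(2)[of "r - s"] s that by (simp add: T_def geod_add dist_real_def)
    then show "\<exists>e>0. \<forall>y. dist y s < e \<longrightarrow> y \<in> T" using \<tau>(1) by blast
  qed
  moreover have "0 \<in> T" by (simp add: T_def geod_def geod_velocity_def)
  ultimately have "T = UNIV"
    using clopen[of T] by blast
  then show ?thesis by (auto simp: T_def)
qed

section \<open>Leaves as chords of the Klein model\<close>

lemma ideal_pt_scaleR:
  assumes "c \<noteq> 0"
  shows "ideal_pt (c *\<^sub>R u) = ideal_pt u"
  using assms by (simp add: ideal_pt_def)

lemma snd_eq_scaleR_ideal_pt:
  assumes "fst u \<noteq> 0"
  shows "snd u = fst u *\<^sub>R ideal_pt u"
  using assms by (simp add: ideal_pt_def)

text \<open>On the hyperboloid \<open>ideal_pt\<close> is the projection to the Klein ball. The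
  identity \<open>(fst u)\<^sup>2 * (1 - ideal_pt u \<bullet> ideal_pt u) = 1\<close> recovers the
  time coordinate from the image.\<close>

lemma ideal_pt_inj_on_H3: "inj_on ideal_pt H3"
proof (rule inj_onI)
  fix p q assume pq: "p \<in> H3" "q \<in> H3" and eq: "ideal_pt p = ideal_pt q"
  have *: "fst u > 0" "snd u = fst u *\<^sub>R ideal_pt u"
    "(fst u)\<^sup>2 * (1 - ideal_pt u \<bullet> ideal_pt u) = 1"
    if "u \<in> H3" for u
  proof -
    show pos: "fst u > 0" using that by (simp add: H3_def)
    then show s: "snd u = fst u *\<^sub>R ideal_pt u"
      by (simp add: snd_eq_scaleR_ideal_pt)
    have "mink u u = -1" using that by (simp add: H3_def)
    then show "(fst u)\<^sup>2 * (1 - ideal_pt u \<bullet> ideal_pt u) = 1"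
      unfolding mink_def s by (simp add: power2_eq_square algebra_simps)
  qed
  have "(fst p)\<^sup>2 * (1 - ideal_pt q \<bullet> ideal_pt q) = (fst q)\<^sup>2 * (1 - ideal_pt q \<bullet> ideal_pt q)"
    using *(3)[OF pq(1)] *(3)[OF pq(2)] eq by simp
  moreover have "1 - ideal_pt q \<bullet> ideal_pt q \<noteq> 0"
    using *(3)[OF pq(2)] by auto
  ultimately have "(fst p)\<^sup>2 = (fst q)\<^sup>2" by simp
  then have "fst p = fst q"
    using *(1)[OF pq(1)] *(1)[OF pq(2)] by (simp add: power2_eq_iff)
  then show "p = q"
    using *(2)[OF pq(1)] *(2)[OF pq(2)] eq by (simp add: prod_eq_iff)
qed

text \<open>Moving along the geodesic only rescales the null vectors \<open>p + v\<close> and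
  \<open>p - v\<close>, by \<open>exp t\<close> and \<open>exp (-t)\<close>.\<close>

lemma end_plus_geod: "end_plus (geod p v t) (geod_velocity p v t) = end_plus p v"
  and end_minus_geod: "end_minus (geod p v t) (geod_velocity p v t) = end_minus p v"
proof -
  have "geod p v t + geod_velocity p v t = (cosh t + sinh t) *\<^sub>R (p + v)"
    and "geod p v t - geod_velocity p v t = (cosh t - sinh t) *\<^sub>R (p - v)"
    by (simp_all add: geod_def geod_velocity_def algebra_simps)
  then show "end_plus (geod p v t) (geod_velocity p v t) = end_plus p v"
    and "end_minus (geod p v t) (geod_velocity p v t) = end_minus p v"
    by (simp_all add: end_plus_def end_minus_def cosh_plus_sinh cosh_minus_sinh ideal_pt_scaleR)
qed

lemma unit_tangent_fst_pos:
  assumes "unit_tangent p v"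
  shows "fst (p + v) > 0" "fst (p - v) > 0"
  using unit_tangent_fst_less[OF assms] by auto

text \<open>With a common ideal point, \<open>p + v\<close> and \<open>p - v\<close> would be
  multiples of one null vector and hence orthogonal, but their product is -2.\<close>

lemma end_minus_neq_end_plus:
  assumes "unit_tangent p v"
  shows "end_minus p v \<noteq> end_plus p v"
proof
  assume eq: "end_minus p v = end_plus p v"
  define k where "k = end_plus p v"
  have s: "snd (p + v) = fst (p + v) *\<^sub>R k" "snd (p - v) = fst (p - v) *\<^sub>R k"
    using unit_tangent_fst_pos[OF assms] eq snd_eq_scaleR_ideal_pt[of "p + v"]
      snd_eq_scaleR_ideal_pt[of "p - v"]
    by (auto simp: k_def end_plus_def end_minus_def)
  have m: "mink (p + v) (p + v) = 0" "mink (p + v) (p - v) = -2"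
    using assms by (auto simp: unit_tangent_def H3_def mink_bilinear mink_commute[of v p])
  have "fst (p + v) * fst (p + v) * (k \<bullet> k - 1) = 0"
    using m(1) unfolding mink_def s by (simp add: algebra_simps)
  then have "k \<bullet> k = 1"
    using unit_tangent_fst_pos[OF assms] by simp
  then show False
    using m(2) unfolding mink_def s by (simp add: algebra_simps)
qed

text \<open>Up to a positive factor the geodesic is \<open>exp (2 * t)\<close> times
  \<open>p + v\<close>, plus \<open>p - v\<close>. Its Klein projection is thus a convex combination
  of the ends whose weights take every ratio.\<close>

lemma open_segment_ends_imp_geod:
  assumes ut: "unit_tangent p v" and z: "z \<in> open_segment (end_minus p v) (end_plus p v)"
  obtains t where "ideal_pt (geod p v t) = z"
proof -
  define a b where "a = fst (p + v)" and "b = fst (p - v)"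
  have ab: "a > 0" "b > 0" using unit_tangent_fst_pos[OF ut] by (simp_all add: a_def b_def)
  have s: "snd (p + v) = a *\<^sub>R end_plus p v" "snd (p - v) = b *\<^sub>R end_minus p v"
    using ab snd_eq_scaleR_ideal_pt[of "p + v"] snd_eq_scaleR_ideal_pt[of "p - v"]
    by (simp_all add: a_def b_def end_plus_def end_minus_def)
  obtain u where u: "0 < u" "u < 1" "z = (1 - u) *\<^sub>R end_minus p v + u *\<^sub>R end_plus p v"
    using z by (auto simp: in_segment)
  \<comment> \<open>Chosen so that the weights \<open>exp (2 * t) * a\<close> and \<open>b\<close>
    are in the ratio \<open>u\<close> to \<open>1 - u\<close>.\<close>
  define t where "t = ln (u * b / ((1 - u) * a)) / 2"
  have pos: "u * b / ((1 - u) * a) > 0" using u ab by simp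
  have "exp t * exp t = u * b / ((1 - u) * a)"
    using pos by (simp add: t_def flip: exp_add)
  then have E: "exp t * exp t * ((1 - u) * a) = u * b" using u ab by simp
  have g: "(2 * exp t) *\<^sub>R geod p v t = (exp t * exp t) *\<^sub>R (p + v) + (p - v)"
  proof -
    have "exp t * (cosh t + sinh t) = exp t * exp t" "exp t * (cosh t - sinh t) = 1"
      by (simp_all add: cosh_plus_sinh cosh_minus_sinh flip: exp_add)
    then have e: "2 * exp t * cosh t = exp t * exp t + 1" "2 * exp t * sinh t = exp t * exp t - 1"
      by (simp_all add: algebra_simps)
    have "(2 * exp t) *\<^sub>R geod p v t =
        (2 * exp t * cosh t) *\<^sub>R p + (2 * exp t * sinh t) *\<^sub>R v"
      by (simp add: geod_def scaleR_add_right)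
    then show ?thesis unfolding e by (simp add: algebra_simps)
  qed
  have ee: "exp t * exp t * a * (1 - u) = u * b" using E by algebra
  have den: "exp t * exp t * a + b > 0" using ab by (simp add: add_pos_pos)
  have "exp t * exp t * a = u * (exp t * exp t * a + b)" "b = (1 - u) * (exp t * exp t * a + b)"
    using ee by algebra+
  then have c: "exp t * exp t * a / (exp t * exp t * a + b) = u"
    "b / (exp t * exp t * a + b) = 1 - u"
    using den by (metis less_irrefl nonzero_eq_divide_eq)+
  have "ideal_pt (geod p v t) = ideal_pt ((exp t * exp t) *\<^sub>R (p + v) + (p - v))"
    unfolding g[symmetric] by (simp add: ideal_pt_scaleR)
  also have "\<dots> = (1 / (exp t * exp t * a + b)) *\<^sub>R
      ((exp t * exp t * a) *\<^sub>R end_plus p v + b *\<^sub>R end_minus p v)"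
    using s by (simp add: ideal_pt_def a_def b_def)
  also have "\<dots> = u *\<^sub>R end_plus p v + (1 - u) *\<^sub>R end_minus p v"
    by (simp add: scaleR_add_right c)
  finally show thesis using that u(3) by (simp add: add.commute)
qed

text \<open>A point of a leaf's chord is the projection of a point of the hyperboloid on that leaf.
  Injectivity of the projection makes the two points agree, and a point determines its leaf.\<close>

lemma leaf_space_chords_disjoint:
  assumes V: "geodesic_foliation V"
    and m: "m \<in> leaf_space V" "z \<in> open_segment (fst m) (snd m)"
    and m': "m' \<in> leaf_space V" "z \<in> open_segment (fst m') (snd m')"
  shows "m = m'"
proof -
  have *: "\<exists>q\<in>H3. ideal_pt q = z \<and> m = (end_minus q (V q), end_plus q (V q))"
    if m: "m \<in> leaf_space V" "z \<in> open_segment (fst m) (snd m)" for m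
  proof -
    obtain p where p: "p \<in> H3" "m = (end_minus p (V p), end_plus p (V p))"
      using m by (auto simp: leaf_space_def)
    have ut: "unit_tangent p (V p)" using V p by (simp add: geodesic_foliation_def)
    obtain t where t: "ideal_pt (geod p (V p) t) = z"
      using open_segment_ends_imp_geod[OF ut] m p by auto
    moreover have "geod p (V p) t \<in> H3"
      using unit_tangent_geod[OF ut] by (simp add: unit_tangent_def)
    ultimately show ?thesis
      using p foliation_along_geod[OF V, of p t]
      by (intro bexI[of _ "geod p (V p) t"]) (simp_all add: end_plus_geod end_minus_geod)
  qed
  show ?thesis
    using *[OF m] *[OF m'] ideal_pt_inj_on_H3 by (metis inj_onD)
qed

section \<open>The Brouwer argument at a common ideal endpoint\<close>

text \<open>The section \<open>g\<close> gives a continuous family of chords, one ending at each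
  \<open>q\<close> in \<open>W\<close>; no other chord can end in \<open>W\<close>. Keeping
  \<open>f\<close> and \<open>h\<close> abstract allows the two ends to be exchanged.\<close>

lemma chord_section_unique:
  fixes f h :: "'b \<Rightarrow> 'a::euclidean_space"
  assumes sphere: "\<And>m. m \<in> M \<Longrightarrow> f m \<in> sphere 0 1" "\<And>m. m \<in> M \<Longrightarrow> h m \<in> sphere 0 1"
    and ne: "\<And>m. m \<in> M \<Longrightarrow> h m \<noteq> f m"
    and disj: "\<And>m m' z. \<lbrakk>m \<in> M; m' \<in> M; z \<in> open_segment (h m) (f m);
      z \<in> open_segment (h m') (f m')\<rbrakk> \<Longrightarrow> m = m'"
    and W: "openin (top_of_set (sphere 0 1)) W"
    and g: "\<And>q. q \<in> W \<Longrightarrow> g q \<in> M" "\<And>q. q \<in> W \<Longrightarrow> f (g q) = q"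
      "continuous_on W (\<lambda>q. h (g q))"
    and m: "m \<in> M" "f m \<in> W"
  shows "g (f m) = m"
proof -
  \<comment> \<open>Both \<open>b\<close> and \<open>\<beta> p\<close> are starting points of chords
    ending at \<open>p\<close>; that they agree is not yet known.\<close>
  define p b \<beta> where "p = f m" and "b = h m" and "\<beta> q = h (g q)" for q
  have pW: "p \<in> W" and p1: "norm p = 1" and b1: "norm b = 1" and bp: "b \<noteq> p"
    using m sphere ne by (auto simp: p_def b_def)
  have \<beta>: "norm (\<beta> q) = 1" "\<beta> q \<noteq> q" if "q \<in> W" for q
    using g(1,2)[of q] sphere(2)[of "g q"] ne[of "g q"] that by (auto simp: \<beta>_def)
  have cont\<beta>: "continuous_on W \<beta>"
    using g(3) unfolding \<beta>_def .
  define d where "d = dist (\<beta> p) p"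
  have d: "d > 0" using \<beta>[OF pW] by (simp add: d_def)
  obtain \<delta>1 where \<delta>1: "\<delta>1 > 0" "\<And>q. norm q = 1 \<Longrightarrow> dist q p < \<delta>1 \<Longrightarrow> q \<in> W"
    using W pW unfolding openin_euclidean_subtopology_iff by (auto simp: dist_commute)
  obtain \<delta>2 where \<delta>2: "\<delta>2 > 0" "\<And>q. q \<in> W \<Longrightarrow> dist q p < \<delta>2 \<Longrightarrow> dist (\<beta> q) (\<beta> p) < d / 2"
    using cont\<beta> pW d unfolding continuous_on_iff by (metis half_gt_zero)
  \<comment> \<open>Normalising a point of the ball at most doubles the bound on its distance from
    \<open>p\<close>, so \<open>2 * r\<close> has to stay below both radii;
    \<open>r \<le> 1 / 2\<close> keeps the origin out of the ball.\<close>
  define r where "r = min (1 / 2) (min \<delta>1 \<delta>2 / 3)"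
  have r: "r > 0" "r \<le> 1 / 2" "2 * r < \<delta>1" "2 * r < \<delta>2"
    using \<delta>1(1) \<delta>2(1) by (auto simp: r_def)
  \<comment> \<open>Composing with this retraction lets Brouwer's theorem run on a ball instead of a spherical cap.\<close>
  define N :: "'a \<Rightarrow> 'a" where "N x = x /\<^sub>R norm x" for x
  have N: "x \<noteq> 0" "norm (N x) = 1" "N x \<in> W" "dist (\<beta> (N x)) (\<beta> p) < d / 2"
    if "x \<in> cball p r" for x
  proof -
    have x: "norm (x - p) \<le> r" using that by (simp add: dist_norm norm_minus_commute)
    have nx: "\<bar>1 - norm x\<bar> \<le> r" using norm_triangle_ineq3[of x p] x p1 by simp
    then show x0: "x \<noteq> 0" using r by auto
    then show N1: "norm (N x) = 1" by (simp add: N_def)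
    have "N x - x = (1 - norm x) *\<^sub>R N x"
      using x0 by (simp add: N_def algebra_simps)
    then have "norm (N x - x) \<le> r" using N1 nx by simp
    then have dN: "dist (N x) p \<le> 2 * r"
      using x norm_triangle_ineq[of "N x - x" "x - p"] by (simp add: dist_norm)
    show NW: "N x \<in> W" using \<delta>1(2)[OF N1] dN r by simp
    show "dist (\<beta> (N x)) (\<beta> p) < d / 2" using \<delta>2(2)[OF NW] dN r by simp
  qed
  \<comment> \<open>The bound \<open>d / 8\<close> puts \<open>z\<close> within \<open>d / 4\<close>
    of \<open>p\<close>, which leaves \<open>d / 4\<close> for the length of \<open>w\<close>. The
    last bound absorbs the error \<open>2 * \<epsilon> + 16 * \<epsilon> / d\<close> of
    \<open>G\<close> into \<open>r\<close>.\<close>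
  define \<epsilon> where "\<epsilon> = min (1 / 2) (min (d / 8) (r / (2 + 16 / d)))"
  have D: "2 + 16 / d > 0" using d by (simp add: add_pos_pos)
  have \<epsilon>: "0 < \<epsilon>" "\<epsilon> < 1" using d r D by (auto simp: \<epsilon>_def)
  have \<epsilon>d: "\<epsilon> \<le> d / 8" unfolding \<epsilon>_def by (rule min.coboundedI2, rule min.coboundedI1) simp
  have "\<epsilon> \<le> r / (2 + 16 / d)" by (simp add: \<epsilon>_def)
  then have \<epsilon>r: "\<epsilon> * (2 + 16 / d) \<le> r" using D by (simp add: pos_le_divide_eq)
  define z where "z = (1 - \<epsilon>) *\<^sub>R p + \<epsilon> *\<^sub>R b"
  have zseg: "z \<in> open_segment b p"
    using \<epsilon> bp by (auto simp: in_segment z_def intro!: exI[of _ "1 - \<epsilon>"])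
  have zp: "norm (z - p) \<le> 2 * \<epsilon>"
  proof -
    have "z - p = \<epsilon> *\<^sub>R (b - p)" by (simp add: z_def algebra_simps)
    then have "norm (z - p) = \<epsilon> * norm (b - p)" using \<epsilon> by simp
    also have "\<dots> \<le> \<epsilon> * 2"
      using \<epsilon> b1 p1 norm_triangle_ineq4[of b p] by (intro mult_left_mono) auto
    finally show ?thesis by simp
  qed
  have z1: "norm z < 1"
  proof -
    have "p \<bullet> p = 1" "b \<bullet> b = 1" using p1 b1 by (simp_all add: norm_eq_1)
    then have "(norm z)\<^sup>2 = 1 - \<epsilon> * (1 - \<epsilon>) * (norm (p - b))\<^sup>2"
      unfolding z_def power2_norm_eq_inner
      by (simp add: inner_commute algebra_simps power2_eq_square)
    moreover have "\<epsilon> * (1 - \<epsilon>) * (norm (p - b))\<^sup>2 > 0" using \<epsilon> bp by simp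
    ultimately have "(norm z)\<^sup>2 < 1\<^sup>2" by simp
    then show ?thesis by (rule power2_less_imp_less) simp
  qed
  have z2: "1 - (norm z)\<^sup>2 \<le> 4 * \<epsilon>"
  proof -
    have "1 - norm z \<le> 2 * \<epsilon>" using norm_triangle_ineq3[of z p] zp p1 by simp
    then have "(1 - norm z) * (1 + norm z) \<le> (2 * \<epsilon>) * 2"
      using z1 \<epsilon> by (intro mult_mono) auto
    then show ?thesis by (simp add: power2_eq_square algebra_simps)
  qed
  have z3: "(norm z)\<^sup>2 < 1" using z1 by (simp add: power_less_one_iff)
  define w where "w q = z - \<beta> q" for q
  \<comment> \<open>Power of the point \<open>z\<close>: the two pieces of the secant through
    \<open>z\<close> have product of lengths \<open>1 - (norm z)\<^sup>2\<close>.\<close>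
  define l where "l q = 1 + (1 - (norm z)\<^sup>2) / (norm (w q))\<^sup>2" for q
  \<comment> \<open>The second intersection of the unit sphere with the line through \<^term>\<open>\<beta> q\<close> and \<^term>\<open>z\<close>.\<close>
  define G where "G q = \<beta> q + l q *\<^sub>R w q" for q
  have w: "norm (w (N x)) \<ge> d / 4" if "x \<in> cball p r" for x
  proof -
    have "d \<le> dist (\<beta> (N x)) (\<beta> p) + (dist z (\<beta> (N x)) + dist z p)"
      unfolding d_def
      by (metis add_left_mono dist_commute dist_triangle order_trans)
    then have "d \<le> dist (\<beta> (N x)) (\<beta> p) + norm (w (N x)) + norm (z - p)"
      by (simp add: w_def dist_norm)
    then show ?thesis using N(4)[OF that] zp \<epsilon>d by simp
  qed
  have w0: "w (N x) \<noteq> 0" if "x \<in> cball p r" for x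
    using w[OF that] d by auto
  have G1: "norm (G (N x)) = 1" if "x \<in> cball p r" for x
  proof -
    let ?q = "N x"
    have "\<beta> ?q \<bullet> \<beta> ?q = 1"
      using \<beta>(1)[OF N(3)[OF that]] by (simp add: norm_eq_1)
    moreover have "(norm z)\<^sup>2 = (\<beta> ?q + w ?q) \<bullet> (\<beta> ?q + w ?q)"
      by (simp add: w_def power2_norm_eq_inner)
    ultimately have "(norm z)\<^sup>2 = 1 + 2 * (\<beta> ?q \<bullet> w ?q) + w ?q \<bullet> w ?q"
      by (simp add: inner_add_left inner_add_right inner_commute)
    then have "l ?q * (w ?q \<bullet> w ?q) = - 2 * (\<beta> ?q \<bullet> w ?q)"
      using w0[OF that] by (simp add: l_def power2_norm_eq_inner field_simps)
    moreover have "G ?q \<bullet> G ?q = 1 + l ?q * (2 * (\<beta> ?q \<bullet> w ?q) + l ?q * (w ?q \<bullet> w ?q))"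
      using \<open>\<beta> ?q \<bullet> \<beta> ?q = 1\<close>
      by (simp add: G_def inner_add_left inner_add_right inner_commute algebra_simps)
    ultimately show ?thesis by (simp add: norm_eq_1)
  qed
  have Gr: "G (N x) \<in> cball p r" if "x \<in> cball p r" for x
  proof -
    let ?q = "N x"
    have nw: "norm (w ?q) > 0" using w0[OF that] by simp
    have "G ?q - z = ((1 - (norm z)\<^sup>2) / (norm (w ?q))\<^sup>2) *\<^sub>R w ?q"
      by (simp add: G_def l_def w_def algebra_simps)
    then have "norm (G ?q - z) = (1 - (norm z)\<^sup>2) / norm (w ?q)"
      using z3 nw by (simp add: power2_eq_square)
    also have "\<dots> \<le> (4 * \<epsilon>) / (d / 4)"
      using z2 z3 w[OF that] d by (intro frac_le) auto
    finally have "norm (G ?q - p) \<le> \<epsilon> * (2 + 16 / d)"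
      using zp norm_triangle_ineq[of "G ?q - z" "z - p"] by (simp add: algebra_simps)
    then show ?thesis using \<epsilon>r by (simp add: dist_norm norm_minus_commute)
  qed
  have "continuous_on (cball p r) N"
    unfolding N_def using N(1) by (intro continuous_intros) auto
  then have "continuous_on (cball p r) (\<lambda>x. \<beta> (N x))"
    by (rule continuous_on_compose2[OF cont\<beta>]) (use N(3) in blast)
  then have "continuous_on (cball p r) (\<lambda>x. G (N x))"
    unfolding G_def l_def w_def
    by (intro continuous_intros) (use w0 in \<open>auto simp: w_def\<close>)
  then obtain x where x: "x \<in> cball p r" "G (N x) = x"
    using brouwer_ball[OF r(1), of p "\<lambda>x. G (N x)"] Gr by blast
  \<comment> \<open>The fixed point lies on the sphere, where \<open>N\<close> is the identity, so
    it is a fixed point of \<open>G\<close> itself.\<close>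
  have "norm x = 1" using G1[OF x(1)] x(2) by simp
  then have Nx: "N x = x" by (simp add: N_def)
  have xW: "x \<in> W" using N(3)[OF x(1)] Nx by simp
  \<comment> \<open>Since \<open>z\<close> is inside the ball, it lies strictly between
    \<open>\<beta> x\<close> and \<open>x\<close>.\<close>
  have l: "l x > 1"
    using z3 w0[OF x(1)] by (simp add: l_def Nx)
  have "x - \<beta> x = l x *\<^sub>R (z - \<beta> x)"
    using x(2) by (simp add: Nx G_def w_def algebra_simps)
  then have "z - \<beta> x = (1 / l x) *\<^sub>R (x - \<beta> x)" using l by simp
  then have "z = (1 - 1 / l x) *\<^sub>R \<beta> x + (1 / l x) *\<^sub>R x"
    by (simp add: algebra_simps)
  then have "z \<in> open_segment (\<beta> x) x"
    using l \<beta>(2)[OF xW] by (auto simp: in_segment intro!: exI[of _ "1 / l x"])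
  \<comment> \<open>The chords of \<open>g x\<close> and \<open>m\<close> share \<open>z\<close>;
    applying \<open>f\<close> then gives \<open>x = f m\<close>.\<close>
  then have "g x = m"
    using disj[of "g x" m z] g(1,2)[OF xW] m(1) zseg by (simp add: \<beta>_def b_def p_def)
  then show ?thesis using g(2)[OF xW] by simp
qed

section \<open>Smooth maps and the Gauss maps\<close>

lemma Ck_on_subset:
  assumes "Ck_on k S f" "T \<subseteq> S"
  shows "Ck_on k T f"
  using assms(1)
proof (induction k arbitrary: f)
  case 0
  then show ?case using assms(2) continuous_on_subset by auto
next
  case (Suc k)
  then show ?case using differentiable_on_subset[OF _ assms(2), of f] by simp
qed

lemma smooth_on_open_subset:
  assumes "smooth_on S f" "open T" "T \<subseteq> S"
  shows "smooth_on T f"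
  using assms Ck_on_subset unfolding smooth_on_def by blast

lemma smooth_map_on_subset:
  assumes "smooth_map_on A f" "B \<subseteq> A"
  shows "smooth_map_on B f"
  unfolding smooth_map_on_def
proof
  fix x assume "x \<in> B"
  then have "x \<in> A" using assms(2) by blast
  then obtain W g where "open W" "x \<in> W" "smooth_on W g" "\<forall>y\<in>A \<inter> W. g y = f y"
    using assms(1) unfolding smooth_map_on_def by meson
  then show "\<exists>W g. open W \<and> x \<in> W \<and> smooth_on W g \<and> (\<forall>y\<in>B \<inter> W. g y = f y)"
    using assms(2) by (intro exI[of _ W] exI[of _ g]) auto
qed

lemma smooth_map_on_cong:
  assumes "smooth_map_on A f" "\<And>x. x \<in> A \<Longrightarrow> f x = f' x"
  shows "smooth_map_on A f'"
  using assms unfolding smooth_map_on_def by simp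

lemma smooth_map_on_locally:
  assumes "\<And>x. x \<in> A \<Longrightarrow> \<exists>T. open T \<and> x \<in> T \<and> smooth_map_on (A \<inter> T) f"
  shows "smooth_map_on A f"
  unfolding smooth_map_on_def
proof
  fix x assume x: "x \<in> A"
  then obtain T where T: "open T" "x \<in> T" "smooth_map_on (A \<inter> T) f"
    using assms by blast
  then obtain W g where W: "open W" "x \<in> W" "smooth_on W g" "\<forall>y\<in>A \<inter> T \<inter> W. g y = f y"
    using x unfolding smooth_map_on_def by (meson IntI)
  have "smooth_on (W \<inter> T) g"
    using W T by (intro smooth_on_open_subset[OF W(3)]) auto
  moreover have "open (W \<inter> T)" "x \<in> W \<inter> T" "\<forall>y\<in>A \<inter> (W \<inter> T). g y = f y"
    using W T by auto
  ultimately show "\<exists>W g. open W \<and> x \<in> W \<and> smooth_on W g \<and> (\<forall>y\<in>A \<inter> W. g y = f y)"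
    by blast
qed

lemma smooth_map_on_imp_continuous_on:
  assumes "smooth_map_on A f"
  shows "continuous_on A f"
  unfolding continuous_on_eq_continuous_within
proof
  fix x assume x: "x \<in> A"
  then obtain W g where W: "open W" "x \<in> W" "smooth_on W g" "\<forall>y\<in>A \<inter> W. g y = f y"
    using assms unfolding smooth_map_on_def by blast
  have "Ck_on 0 W g" using W(3) unfolding smooth_on_def by blast
  then have "continuous_on (A \<inter> W) g" by (auto intro: continuous_on_subset)
  then have "continuous_on (A \<inter> W) f" by (rule continuous_on_eq) (use W(4) in blast)
  then have "continuous (at x within A \<inter> W) f"
    using x W(2) by (auto simp: continuous_on_eq_continuous_within)
  then show "continuous (at x within A) f"
    using at_within_nhd[of x W "A \<inter> W" A] W(1,2) by auto
qed

section \<open>From local diffeomorphisms to injectivity and global inverses\<close>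

text \<open>By injectivity the global inverse agrees near each image point with the smooth local
  inverse there.\<close>

lemma diffeo_betw_of_local_diffeo_on:
  assumes f: "local_diffeo_on M f N" and inj: "inj_on f M"
  shows "diffeo_betw f M (f ` M)"
  unfolding diffeo_betw_def
proof (intro conjI smooth_map_on_locally)
  show "bij_betw f M (f ` M)" using inj by (rule inj_on_imp_bij_betw)
next
  fix m assume m: "m \<in> M"
  then obtain U where U: "openin (top_of_set M) U" "m \<in> U" "smooth_map_on U f"
    using f unfolding local_diffeo_on_def by metis
  then show "\<exists>T. open T \<and> m \<in> T \<and> smooth_map_on (M \<inter> T) f"
    by (auto simp: openin_open)
next
  fix y assume "y \<in> f ` M"
  then obtain m where m: "m \<in> M" "y = f m" by blast
  obtain U W g where U: "openin (top_of_set M) U" "m \<in> U" "openin (top_of_set N) W"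
    "bij_betw f U W" "smooth_map_on W g" "\<forall>x\<in>U. g (f x) = x"
    using f m(1) unfolding local_diffeo_on_def by metis
  obtain T where T: "open T" "W = N \<inter> T" using U(3) by (auto simp: openin_open)
  have UM: "U \<subseteq> M" using U(1) by (rule openin_imp_subset)
  have fU: "f ` U = W" using U(4) by (simp add: bij_betw_def)
  have sub: "f ` M \<inter> T \<subseteq> W" using f T(2) by (auto simp: local_diffeo_on_def)
  have "smooth_map_on (f ` M \<inter> T) (inv_into M f)"
  proof (rule smooth_map_on_cong)
    show "smooth_map_on (f ` M \<inter> T) g" by (rule smooth_map_on_subset[OF U(5) sub])
    fix x assume "x \<in> f ` M \<inter> T"
    then obtain u where "u \<in> U" "x = f u" using sub fU by blast
    then show "g x = inv_into M f x" using U(6) UM inj by (auto simp: inv_into_f_f)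
  qed
  moreover have "y \<in> T" using m(2) U(2) fU T(2) by blast
  ultimately show "\<exists>T. open T \<and> y \<in> T \<and> smooth_map_on (f ` M \<inter> T) (inv_into M f)"
    using T(1) by blast
qed

text \<open>One local inverse \<open>g\<close> of \<open>f\<close> near \<open>m\<close> serves both
  points: each is the value of \<open>g\<close> at the common image, by uniqueness of the chord
  ending there.\<close>

lemma inj_on_of_local_diffeo_on_chords:
  fixes M :: "'b::euclidean_space set" and f h :: "'b \<Rightarrow> 'a::euclidean_space"
  assumes f: "local_diffeo_on M f (sphere 0 1)"
    and h: "continuous_on M h" "h ` M \<subseteq> sphere 0 1"
    and ne: "\<And>m. m \<in> M \<Longrightarrow> h m \<noteq> f m"
    and disj: "\<And>m m' z. \<lbrakk>m \<in> M; m' \<in> M; z \<in> open_segment (h m) (f m);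
      z \<in> open_segment (h m') (f m')\<rbrakk> \<Longrightarrow> m = m'"
  shows "inj_on f M"
proof (rule inj_onI)
  fix m m' assume m: "m \<in> M" "m' \<in> M" "f m = f m'"
  obtain U W g where U: "openin (top_of_set M) U" "m \<in> U" "openin (top_of_set (sphere 0 1)) W"
    "bij_betw f U W" "smooth_map_on W g" "\<forall>x\<in>U. g (f x) = x"
    using f m(1) unfolding local_diffeo_on_def by metis
  have fU: "f ` U = W" using U(4) by (simp add: bij_betw_def)
  have UM: "U \<subseteq> M" using U(1) by (rule openin_imp_subset)
  have g: "g q \<in> M" "f (g q) = q" if "q \<in> W" for q
    using that fU U(6) UM by auto
  have fM: "f x \<in> sphere 0 1" if "x \<in> M" for x
    using f that by (auto simp: local_diffeo_on_def)
  have cont: "continuous_on W (\<lambda>q. h (g q))"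
    by (rule continuous_on_compose2[OF h(1) smooth_map_on_imp_continuous_on[OF U(5)]])
      (use g in auto)
  have fW: "f m \<in> W" using fU U(2) by blast
  have *: "g (f x) = x" if "x \<in> M" "f x \<in> W" for x
    by (rule chord_section_unique[where h = h and M = M and W = W])
      (use fM h(2) ne disj U(3) g cont that in \<open>auto simp del: mem_sphere\<close>)
  show "m = m'"
    using *[OF m(1) fW] *[of m'] m fW by simp
qed

theorem theorem4p6:
  fixes V :: "pt \<Rightarrow> pt"
  assumes "geodesic_foliation V"
    and "semi_nondegenerate V"
  shows "inj_on gauss_plus (leaf_space V) \<and> inj_on gauss_minus (leaf_space V) \<and>
         diffeo_betw gauss_plus (leaf_space V) (gauss_plus ` leaf_space V) \<and>
         diffeo_betw gauss_minus (leaf_space V) (gauss_minus ` leaf_space V)"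
proof -
  let ?M = "leaf_space V"
  have plus: "local_diffeo_on ?M gauss_plus (sphere 0 1)"
    and minus: "local_diffeo_on ?M gauss_minus (sphere 0 1)"
    using assms(2) by (simp_all add: semi_nondegenerate_def S2_def)
  have im: "gauss_plus ` ?M \<subseteq> sphere 0 1" "gauss_minus ` ?M \<subseteq> sphere 0 1"
    using plus minus by (auto simp: local_diffeo_on_def)
  have ne: "gauss_minus m \<noteq> gauss_plus m" if m: "m \<in> ?M" for m
  proof -
    obtain p where p: "p \<in> H3" "m = (end_minus p (V p), end_plus p (V p))"
      using m unfolding leaf_space_def by blast
    moreover have "unit_tangent p (V p)"
      using assms(1) p(1) by (simp add: geodesic_foliation_def)
    ultimately show ?thesis
      using end_minus_neq_end_plus by (simp add: gauss_plus_def gauss_minus_def)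
  qed
  have cont: "continuous_on ?M gauss_plus" "continuous_on ?M gauss_minus"
    unfolding gauss_plus_def gauss_minus_def
    by (rule continuous_on_snd[OF continuous_on_id], rule continuous_on_fst[OF continuous_on_id])
  have disj: "m = m'"
    if "m \<in> ?M" "m' \<in> ?M" "z \<in> open_segment (gauss_minus m) (gauss_plus m)"
      "z \<in> open_segment (gauss_minus m') (gauss_plus m')" for m m' z
    using leaf_space_chords_disjoint[OF assms(1), of m z m'] that
    by (simp add: gauss_plus_def gauss_minus_def)
  have inj_plus: "inj_on gauss_plus ?M"
    by (rule inj_on_of_local_diffeo_on_chords[OF plus cont(2) im(2) ne disj])
  \<comment> \<open>Reversing all orientations exchanges the two ends and leaves the open chords
    unchanged.\<close>
  have inj_minus: "inj_on gauss_minus ?M"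
  proof (rule inj_on_of_local_diffeo_on_chords[OF minus cont(1) im(1)])
    show "gauss_plus m \<noteq> gauss_minus m" if "m \<in> ?M" for m
      using ne[OF that] by simp
    show "m = m'"
      if "m \<in> ?M" "m' \<in> ?M" "z \<in> open_segment (gauss_plus m) (gauss_minus m)"
        "z \<in> open_segment (gauss_plus m') (gauss_minus m')" for m m' z
      using disj[of m m' z] that by (simp add: open_segment_commute)
  qed
  show ?thesis
    using inj_plus inj_minus diffeo_betw_of_local_diffeo_on[OF plus inj_plus]
      diffeo_betw_of_local_diffeo_on[OF minus inj_minus] by blast
qed

end
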